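(* For each dimension $d\ge1$ let $A\subset\mathbb{R}^d$ be measurable with $p_f(A)>0$, and assume that $p_f(A)\to0$ as $d\to\infty$. Then either $\sup_d D(f\,\|\,g_A)=\infty$ or $\sup_d D(f|_A\,\|\,g_A)=\infty$.
   Context: The dependence of all objects on the dimension $d$ is suppressed. $f$ is the standard Gaussian density on $\mathbb{R}^d$, $p_f(A)=\int_A f$, $f|_A=f1_A/p_f(A)$. $\mu_A$ and $\Sigma_A$ are the mean vector and covariance matrix of $f|_A$, and $g_A=N(\mu_A,\Sigma_A)$ is the Gaussian density with these parameters. $D(h\,\|\,g)=\int h\log(h/g)$ is the Kullback--Leibler divergence. "Either ... or" is inclusive. *)

theory Defs
  imports
    "HOL-Probability.Probability"
    "Jordan_Normal_Form.Gauss_Jordan_Elimination"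
    "Jordan_Normal_Form.Determinant"
begin

text \<open>
  The dimension varies inside the statement, so the points of \<open>\<real>\<^sup>d\<close> are the functions
  \<open>x \<in> {..<d} \<rightarrow>\<^sub>E UNIV\<close>, with coordinates \<open>x 0, \<dots>, x (d - 1)\<close>. As with \<^const>\<open>lebesgue\<close>, the
  completion of the product measure makes the measurable sets the Lebesgue measurable ones.
\<close>

definition lebesgue_Rn :: "nat \<Rightarrow> (nat \<Rightarrow> real) measure" where
  "lebesgue_Rn d = completion (Pi\<^sub>M {..<d} (\<lambda>_. lborel))"

definition std_gauss :: "nat \<Rightarrow> (nat \<Rightarrow> real) \<Rightarrow> real" where
  "std_gauss d x = (\<Prod>i<d. std_normal_density (x i))"

definition gauss_prob :: "nat \<Rightarrow> (nat \<Rightarrow> real) set \<Rightarrow> real" where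
  "gauss_prob d A = (LINT x:A|lebesgue_Rn d. std_gauss d x)"

definition cond_gauss :: "nat \<Rightarrow> (nat \<Rightarrow> real) set \<Rightarrow> (nat \<Rightarrow> real) \<Rightarrow> real" where
  "cond_gauss d A x = std_gauss d x * indicator A x / gauss_prob d A"

definition mean_vec :: "nat \<Rightarrow> ((nat \<Rightarrow> real) \<Rightarrow> real) \<Rightarrow> real vec" where
  "mean_vec d h = vec d (\<lambda>i. LINT x|lebesgue_Rn d. x i * h x)"

definition cov_mat :: "nat \<Rightarrow> ((nat \<Rightarrow> real) \<Rightarrow> real) \<Rightarrow> real mat" where
  "cov_mat d h = mat d d (\<lambda>(i, j). LINT x|lebesgue_Rn d.
     (x i - vec_index (mean_vec d h) i) * (x j - vec_index (mean_vec d h) j) * h x)"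

text \<open>
  The density of \<open>N(m, S)\<close>, meaningful for symmetric positive definite \<open>S\<close>. The covariance matrix
  of a distribution on \<open>\<real>\<^sup>d\<close> that has a density and finite second moments is of this kind: no affine
  hyperplane carries all of the mass. In particular \<^const>\<open>mat_inverse\<close> then returns the inverse.
\<close>

definition mv_normal_density :: "nat \<Rightarrow> real vec \<Rightarrow> real mat \<Rightarrow> (nat \<Rightarrow> real) \<Rightarrow> real" where
  "mv_normal_density d m S x =
     1 / sqrt ((2 * pi) ^ d * Determinant.det S) *
     exp (- (scalar_prod (vec d x - m) (the (mat_inverse S) *\<^sub>v (vec d x - m))) / 2)"

definition gauss_proj :: "nat \<Rightarrow> (nat \<Rightarrow> real) set \<Rightarrow> (nat \<Rightarrow> real) \<Rightarrow> real" where
  "gauss_proj d A = mv_normal_density d (mean_vec d (cond_gauss d A)) (cov_mat d (cond_gauss d A))"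

text \<open>
  \<^const>\<open>KL_divergence\<close> takes the reference measure first, so \<open>kl_div d h g\<close> is \<open>D(h \<parallel> g)\<close>, with the
  natural logarithm; \<open>kl_div_eq\<close> below is the formula for densities. Being a Bochner integral, it
  would be 0 for an integrand that is not integrable. This does not occur for \<open>g = gauss_proj d A\<close>
  and \<open>h = std_gauss d\<close> or \<open>h = cond_gauss d A\<close>: where \<open>h > 0\<close>, \<open>ln (h / g)\<close> is a polynomial
  of degree at most 2 in the coordinates, and \<open>h\<close> has finite second moments.
\<close>

definition kl_div :: "nat \<Rightarrow> ((nat \<Rightarrow> real) \<Rightarrow> real) \<Rightarrow> ((nat \<Rightarrow> real) \<Rightarrow> real) \<Rightarrow> real" where
  "kl_div d h g = KL_divergence (exp 1) (density (lebesgue_Rn d) g) (density (lebesgue_Rn d) h)"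

lemma sigma_finite_lebesgue_Rn: "sigma_finite_measure (lebesgue_Rn d)"
proof -
  interpret finite_product_sigma_finite "\<lambda>_::nat. lborel :: real measure" "{..<d}"
    by standard simp
  obtain F where F: "countable F" "F \<subseteq> sets (Pi\<^sub>M {..<d} (\<lambda>_. lborel :: real measure))"
      "\<Union>F = space (Pi\<^sub>M {..<d} (\<lambda>_. lborel :: real measure))"
      "\<forall>a\<in>F. emeasure (Pi\<^sub>M {..<d} (\<lambda>_. lborel :: real measure)) a \<noteq> \<infinity>"
    using sigma_finite_countable by blast
  show ?thesis
    unfolding lebesgue_Rn_def
  proof (standard, intro exI[of _ F] conjI ballI)
    show "countable F" by fact
    show "F \<subseteq> sets (completion (Pi\<^sub>M {..<d} (\<lambda>_. lborel)))"
      using F(2) by (auto intro: sets_completionI_sets)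
    show "\<Union>F = space (completion (Pi\<^sub>M {..<d} (\<lambda>_. lborel)))"
      using F(3) by simp
    fix a assume "a \<in> F"
    then show "emeasure (completion (Pi\<^sub>M {..<d} (\<lambda>_. lborel))) a \<noteq> \<infinity>"
      using F(2,4) by (subst emeasure_completion) (auto simp: main_part_sets)
  qed
qed

lemma kl_div_eq:
  assumes "h \<in> borel_measurable (lebesgue_Rn d)" "\<And>x. 0 \<le> h x"
    and "g \<in> borel_measurable (lebesgue_Rn d)" "\<And>x. 0 < g x"
  shows "kl_div d h g = (LINT x|lebesgue_Rn d. h x * ln (h x / g x))"
proof -
  interpret sigma_finite_measure "lebesgue_Rn d" by (rule sigma_finite_lebesgue_Rn)
  have "g x \<noteq> 0" "0 \<le> g x" for x using assms(4)[of x] by simp_all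
  then have "kl_div d h g = (LINT x|lebesgue_Rn d. h x * log (exp 1) (h x / g x))"
    unfolding kl_div_def
    using assms by (intro KL_density_density) auto
  then show ?thesis by (simp add: log_def)
qed

end

theory Submission
  imports Defs "Jordan_Normal_Form.Spectral_Radius"
begin

text \<open>
  Write \<open>h = f|\<^sub>A\<close>, \<open>g = g\<^sub>A\<close>, \<open>p = p\<^sub>f(A)\<close>. Since \<open>ln (f / g)\<close> is quadratic and \<open>g\<close> has the moments of \<open>h\<close>,
  the Pythagorean identity \<open>- ln p = D(h \<parallel> f) = D(h \<parallel> g) + D(g \<parallel> f)\<close> holds. In terms of the
  eigenvalues \<open>l\<^sub>i\<close> of the covariance matrix and the coordinates \<open>v\<^sub>i\<close> of the mean in an orthonormal
  eigenbasis, \<open>2 D(f \<parallel> g) = \<Sum> (1 / l\<^sub>i - 1 + ln l\<^sub>i) + \<Sum> v\<^sub>i\<^sup>2 / l\<^sub>i\<close> and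
  \<open>2 D(g \<parallel> f) = \<Sum> (l\<^sub>i - 1 - ln l\<^sub>i) + \<Sum> v\<^sub>i\<^sup>2\<close>. A bound on the former bounds every \<open>l\<^sub>i\<close> above by some
  \<open>M\<close> independent of the dimension, and then \<open>D(g \<parallel> f) \<le> M D(f \<parallel> g)\<close>. So if both divergences of the
  theorem are bounded, then \<open>p\<close> is bounded away from 0.
\<close>

subsection \<open>Diagonalization of real symmetric matrices\<close>

text \<open>A complex eigenvector \<open>w = a + i b\<close> exists because the complex spectrum is
  nonempty. Symmetry gives \<open>b^T A a = a^T A b\<close>; inserting the real and imaginary parts
  of the eigenvalue equation, the terms with \<open>Re k\<close> cancel and
  \<open>Im k * (|a|^2 + |b|^2) = 0\<close> remains. So \<open>k\<close> is real, both
  \<open>a\<close> and \<open>b\<close> satisfy the eigenvalue equation, and one of them is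
  nonzero.\<close>

lemma real_symmetric_eigenvector:
  fixes A :: "real mat"
  assumes A: "A \<in> carrier_mat n n" and sym: "transpose_mat A = A" and n: "n > 0"
  obtains v k where "v \<in> carrier_vec n" "v \<noteq> 0\<^sub>v n" "A *\<^sub>v v = k \<cdot>\<^sub>v v"
proof -
  define B where "B = map_mat complex_of_real A"
  have B: "B \<in> carrier_mat n n" using A by (simp add: B_def)
  from spectrum_non_empty[OF B n] obtain k where "eigenvalue B k" by (auto simp: spectrum_def)
  then obtain w where w: "w \<in> carrier_vec n" "w \<noteq> 0\<^sub>v n" "B *\<^sub>v w = k \<cdot>\<^sub>v w"
    using B by (auto simp: eigenvalue_def eigenvector_def)
  define a where "a i = Re (vec_index w i)" for i
  define b where "b i = Im (vec_index w i)" for i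
  have eq: "(\<Sum>j<n. complex_of_real (A $$ (i,j)) * vec_index w j) = k * vec_index w i" if "i < n" for i
  proof -
    have "vec_index (B *\<^sub>v w) i = (\<Sum>j<n. complex_of_real (A $$ (i,j)) * vec_index w j)"
      using that A w(1) by (simp add: B_def scalar_prod_def atLeast0LessThan)
    then show ?thesis using w(1,3) that by simp
  qed
  have eqa: "(\<Sum>j<n. A $$ (i,j) * a j) = Re k * a i - Im k * b i"
    and eqb: "(\<Sum>j<n. A $$ (i,j) * b j) = Im k * a i + Re k * b i" if "i < n" for i
    using arg_cong[OF eq[OF that], of Re] arg_cong[OF eq[OF that], of Im]
    by (simp_all add: a_def b_def add.commute)
  have symm: "A $$ (i,j) = A $$ (j,i)" if "i < n" "j < n" for i j
    using arg_cong[OF sym, of "\<lambda>M. M $$ (j,i)"] that A by simp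
  have "(\<Sum>i<n. b i * (\<Sum>j<n. A $$ (i,j) * a j)) = (\<Sum>i<n. a i * (\<Sum>j<n. A $$ (i,j) * b j))"
    unfolding sum_distrib_left by (subst sum.swap) (auto intro!: sum.cong simp: symm)
  then have "(\<Sum>i<n. b i * (Re k * a i - Im k * b i)) = (\<Sum>i<n. a i * (Im k * a i + Re k * b i))"
    using eqa eqb by simp
  then have "Im k * (\<Sum>i<n. (a i)\<^sup>2 + (b i)\<^sup>2) = 0"
    by (simp add: algebra_simps sum.distrib sum_subtractf sum_distrib_left power2_eq_square sum_negf)
  moreover have "(\<Sum>i<n. (a i)\<^sup>2 + (b i)\<^sup>2) \<noteq> 0"
  proof
    assume "(\<Sum>i<n. (a i)\<^sup>2 + (b i)\<^sup>2) = 0"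
    then have "\<forall>i<n. (a i)\<^sup>2 + (b i)\<^sup>2 = 0" by (subst (asm) sum_nonneg_eq_0_iff) auto
    then have "\<forall>i<n. vec_index w i = 0" by (auto simp: a_def b_def complex_eq_iff sum_power2_eq_zero_iff)
    then show False using w(1,2) by (auto simp: vec_eq_iff)
  qed
  ultimately have Im: "Im k = 0" by simp
  have ev: "A *\<^sub>v vec n a = Re k \<cdot>\<^sub>v vec n a" "A *\<^sub>v vec n b = Re k \<cdot>\<^sub>v vec n b"
    using A eqa eqb Im by (auto intro!: eq_vecI simp: scalar_prod_def atLeast0LessThan)
  show thesis
  proof (cases "vec n a = 0\<^sub>v n")
    case False then show thesis using ev that[of "vec n a" "Re k"] by simp
  next
    case True
    have "vec n b \<noteq> 0\<^sub>v n"
    proof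
      assume "vec n b = 0\<^sub>v n"
      then have "a i = 0 \<and> b i = 0" if "i < n" for i
        using True that by (metis index_vec index_zero_vec(1))
      then show False using w(1,2) by (auto simp: a_def b_def complex_eq_iff vec_eq_iff)
    qed
    then show thesis using ev that[of "vec n b" "Re k"] by simp
  qed
qed

text \<open>\<open>Q = 1 - c w w\<^sup>T\<close> with \<open>w = v - e\<^sub>0\<close> is the reflection that exchanges \<open>e\<^sub>0\<close> and \<open>v\<close>.\<close>

lemma householder_reflection:
  fixes v :: "real vec"
  assumes v: "v \<in> carrier_vec n" and n: "0 < n" and unit: "scalar_prod v v = 1"
  obtains Q where "Q \<in> carrier_mat n n" "transpose_mat Q = Q" "Q * Q = 1\<^sub>m n" "col Q 0 = v"
\<comment> \<open>If the first coordinate of the unit vector \<open>v\<close> is 1, then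
  \<open>v\<close> is \<open>e_0\<close> itself and \<open>w\<close> vanishes; the identity serves
  as \<open>Q\<close>. This case has to be split off because \<open>c\<close> divides by
  \<open>1 - v_0\<close>.\<close>
proof (cases "vec_index v 0 = 1")
  case True
  have s: "(\<Sum>i<n. (vec_index v i)\<^sup>2) = 1"
    using unit v by (simp add: scalar_prod_def atLeast0LessThan power2_eq_square)
  have "(\<Sum>i\<in>{..<n}-{0}. (vec_index v i)\<^sup>2) = 0"
    using s n True by (subst (asm) sum.remove[of _ 0]) auto
  then have "\<forall>i\<in>{..<n}-{0}. vec_index v i = 0"
    by (subst (asm) sum_nonneg_eq_0_iff) auto
  then have "v = unit_vec n 0" using v True by (auto simp: vec_eq_iff)
  then show thesis using n by (intro that[of "1\<^sub>m n"]) auto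
next
  case False
  define w where "w i = vec_index v i - (if i = 0 then 1 else 0)" for i
  define c where "c = 1 / (1 - vec_index v 0)"
  define Q where "Q = mat n n (\<lambda>(i,j). (if i = j then 1 else 0) - c * w i * w j)"
  have s: "(\<Sum>i<n. (vec_index v i)\<^sup>2) = 1"
    using unit v by (simp add: scalar_prod_def atLeast0LessThan power2_eq_square)
  \<comment> \<open>Since \<open>|v| = 1\<close>, the square \<open>|v - e_0|^2\<close> equals
    \<open>2 (1 - v_0)\<close>. Thus \<open>c = 2 / |w|^2\<close>, the constant that makes
    \<open>1 - c w w^T\<close> an involution.\<close>
  have "(\<Sum>i<n. (w i)\<^sup>2) =
      (\<Sum>i<n. (vec_index v i)\<^sup>2 + (if i = 0 then 1 - 2 * vec_index v i else 0))"
    by (intro sum.cong) (auto simp: w_def power2_eq_square algebra_simps)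
  also have "\<dots> = 2 * (1 - vec_index v 0)" using n s by (simp add: sum.distrib)
  finally have ww: "c * (\<Sum>i<n. (w i)\<^sup>2) = 2" using False by (simp add: c_def field_simps)
  have "Q * Q = 1\<^sub>m n"
  proof (rule eq_matI)
    fix i j assume "i < dim_row (1\<^sub>m n :: real mat)" "j < dim_col (1\<^sub>m n :: real mat)"
    then have ij: "i < n" "j < n" by auto
    have "(Q * Q) $$ (i,j) = (\<Sum>k<n. ((if i = k then 1 else 0) - c * w i * w k)
        * ((if k = j then 1 else 0) - c * w k * w j))"
      using ij by (simp add: Q_def scalar_prod_def atLeast0LessThan)
    also have "\<dots> = (\<Sum>k<n. (if k = i then if i = j then 1 else 0 else 0)
        - (if k = i then c * w i * w j else 0)
        - (if k = j then c * w i * w j else 0) + c * (w k)\<^sup>2 * (c * w i * w j))"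
      by (intro sum.cong) (auto simp: algebra_simps power2_eq_square)
    also have "\<dots> = (if i = j then 1 else 0) - 2 * (c * w i * w j)
        + (c * (\<Sum>k<n. (w k)\<^sup>2)) * (c * w i * w j)"
      using ij by (simp add: sum.distrib sum_subtractf sum_distrib_left sum_distrib_right)
    finally show "(Q * Q) $$ (i,j) = 1\<^sub>m n $$ (i,j)" using ij ww by simp
  qed (auto simp: Q_def)
  \<comment> \<open>\<open>Q e_0 = e_0 - c w_0 w\<close>, and \<open>c w_0 = -1\<close>, so this is
    \<open>e_0 + w = v\<close>.\<close>
  moreover have "col Q 0 = v"
    using n v False by (auto intro!: eq_vecI simp: Q_def w_def c_def field_simps)
  ultimately show thesis by (intro that[of Q]) (auto intro!: eq_matI simp: Q_def)
qed

text \<open>Induction on the dimension: a reflection \<open>Q\<close> carries a unit eigenvector to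
  \<open>e_0\<close>, conjugation by \<open>Q\<close> splits off a one-by-one block, and the
  induction hypothesis diagonalizes the other block. The orthogonal matrix for \<open>A\<close> is
  \<open>Q * R\<close>, where \<open>R\<close> extends the smaller one by an entry 1.\<close>

lemma real_symmetric_diagonalization:
  fixes A :: "real mat"
  assumes "A \<in> carrier_mat n n" "transpose_mat A = A"
  shows "\<exists>P l. P \<in> carrier_mat n n \<and> transpose_mat P * P = 1\<^sub>m n \<and>
    A = P * mat_diag n l * transpose_mat P"
  using assms
proof (induction n arbitrary: A)
  case 0
  then show ?case by (intro exI[of _ "1\<^sub>m 0"]) (auto intro!: eq_matI)
next
  case (Suc n A)
  note A = Suc.prems
  obtain u k where u: "u \<in> carrier_vec (Suc n)" "u \<noteq> 0\<^sub>v (Suc n)" "A *\<^sub>v u = k \<cdot>\<^sub>v u"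
    using real_symmetric_eigenvector[OF A] by auto
  have pos: "scalar_prod u u > 0"
  proof -
    have "\<exists>i<Suc n. vec_index u i \<noteq> 0" using u(1,2) by (auto simp: vec_eq_iff)
    then have "(\<Sum>i<Suc n. (vec_index u i)\<^sup>2) > 0"
      by (auto simp del: sum.lessThan_Suc intro!: sum_pos2)
    then show ?thesis using u(1)
      by (simp add: scalar_prod_def atLeast0LessThan power2_eq_square del: sum.lessThan_Suc)
  qed
  define v where "v = (1 / sqrt (scalar_prod u u)) \<cdot>\<^sub>v u"
  have v: "v \<in> carrier_vec (Suc n)" using u by (simp add: v_def)
  have unit: "scalar_prod v v = 1" using pos u(1) by (simp add: v_def)
  have Av: "A *\<^sub>v v = k \<cdot>\<^sub>v v"
    unfolding v_def using A(1) u by (simp add: mult_mat_vec smult_smult_assoc mult.commute)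
  obtain Q where Q: "Q \<in> carrier_mat (Suc n) (Suc n)" "transpose_mat Q = Q"
      "Q * Q = 1\<^sub>m (Suc n)" "col Q 0 = v"
    using householder_reflection[OF v _ unit] by auto
  \<comment> \<open>\<open>e\<^sub>0\<close> is an eigenvector of the symmetric matrix \<open>M\<close>, so \<open>M\<close> is block diagonal.\<close>
  define M where "M = Q * A * Q"
  have M: "M \<in> carrier_mat (Suc n) (Suc n)" using A Q by (simp add: M_def)
  have Msym: "transpose_mat M = M"
  proof -
    have "transpose_mat M = transpose_mat Q * transpose_mat (Q * A)"
      using A Q unfolding M_def by (intro transpose_mult) auto
    also have "transpose_mat (Q * A) = transpose_mat A * transpose_mat Q"
      using A Q by (intro transpose_mult) auto
    finally show ?thesis using A Q by (simp add: M_def assoc_mult_mat[OF Q(1) A(1) Q(1)])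
  qed
  \<comment> \<open>\<open>M e_0 = Q A Q e_0 = Q A v = k Q v\<close>, and \<open>Q v = e_0\<close>
    because \<open>v\<close> is the first column of the involution \<open>Q\<close>.\<close>
  have "col M 0 = (Q * A) *\<^sub>v v" using A Q v by (simp add: M_def col_mult2[of _ "Suc n" "Suc n" _ "Suc n"])
  also have "\<dots> = Q *\<^sub>v (k \<cdot>\<^sub>v v)" using A Q v Av by simp
  also have "\<dots> = k \<cdot>\<^sub>v (Q *\<^sub>v v)" using Q v by (simp add: mult_mat_vec)
  also have "Q *\<^sub>v v = col (Q * Q) 0" using col_mult2[OF Q(1,1), of 0] Q(4) by simp
  also have "\<dots> = unit_vec (Suc n) 0" using Q by simp
  finally have col: "col M 0 = k \<cdot>\<^sub>v unit_vec (Suc n) 0" .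
  have M0: "M $$ (i,0) = (if i = 0 then k else 0)" if "i < Suc n" for i
    using arg_cong[OF col, of "\<lambda>x. vec_index x i"] that M by (auto simp: unit_vec_def)
  have M0': "M $$ (0,i) = (if i = 0 then k else 0)" if "i < Suc n" for i
    using arg_cong[OF Msym, of "\<lambda>N. N $$ (0,i)"] that M M0[OF that] by simp
  define N where "N = mat n n (\<lambda>(i,j). M $$ (Suc i, Suc j))"
  define K where "K = mat 1 1 (\<lambda>_. k)"
  have KN: "K \<in> carrier_mat 1 1" "N \<in> carrier_mat n n" by (auto simp: K_def N_def)
  have MN: "M = four_block_mat K (0\<^sub>m 1 n) (0\<^sub>m n 1) N"
    using M M0 M0' by (intro eq_matI) (auto simp: K_def N_def)
  have "M $$ (j,i) = M $$ (i,j)" if "i < Suc n" "j < Suc n" for i j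
    using arg_cong[OF Msym, of "\<lambda>N. N $$ (i,j)"] that M by simp
  then have Nsym: "transpose_mat N = N" by (auto intro!: eq_matI simp: N_def)
  obtain P l where P: "P \<in> carrier_mat n n" "transpose_mat P * P = 1\<^sub>m n"
      "N = P * mat_diag n l * transpose_mat P"
    using Suc.IH[OF KN(2) Nsym] by auto
  define R where "R = four_block_mat (1\<^sub>m 1) (0\<^sub>m 1 n) (0\<^sub>m n 1) P"
  define L where "L = mat_diag (Suc n) (\<lambda>i. case i of 0 \<Rightarrow> k | Suc j \<Rightarrow> l j)"
  have L: "L = four_block_mat K (0\<^sub>m 1 n) (0\<^sub>m n 1) (mat_diag n l)"
    by (intro eq_matI) (auto simp: L_def K_def mat_diag_def split: nat.splits)
  have Lc: "L \<in> carrier_mat (Suc n) (Suc n)" by (simp add: L_def)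
  have R: "R \<in> carrier_mat (Suc n) (Suc n)"
    unfolding R_def using P by (auto intro!: carrier_matI)
  have RT: "transpose_mat R = four_block_mat (1\<^sub>m 1) (0\<^sub>m 1 n) (0\<^sub>m n 1) (transpose_mat P)"
    unfolding R_def using P by (subst transpose_four_block_mat) auto
  have RR: "transpose_mat R * R = 1\<^sub>m (Suc n)"
    unfolding RT unfolding R_def using P
    by (subst mult_four_block_mat
          [where ?nr1.0 = 1 and ?n1.0 = 1 and ?n2.0 = n and ?nr2.0 = n and ?nc1.0 = 1 and ?nc2.0 = n])
       auto
  have RL: "R * L = four_block_mat K (0\<^sub>m 1 n) (0\<^sub>m n 1) (P * mat_diag n l)"
    unfolding R_def L using P KN
    by (subst mult_four_block_mat
          [where ?nr1.0 = 1 and ?n1.0 = 1 and ?n2.0 = n and ?nr2.0 = n and ?nc1.0 = 1 and ?nc2.0 = n])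
       (auto simp: left_mult_zero_mat[OF mat_diag_dim])
  have "R * L * transpose_mat R = M"
    unfolding RL RT MN P(3) using P KN
    by (subst mult_four_block_mat
          [where ?nr1.0 = 1 and ?n1.0 = 1 and ?n2.0 = n and ?nr2.0 = n and ?nc1.0 = 1 and ?nc2.0 = n])
       (auto simp: right_mult_zero_mat[OF mult_carrier_mat[OF _ mat_diag_dim]])
  have QMQ: "Q * M * Q = A"
  proof -
    have "Q * M * Q = (Q * Q) * A * (Q * Q)"
      unfolding M_def using A(1) Q(1) by (simp add: assoc_mult_mat[of _ "Suc n" "Suc n" _ "Suc n" _ "Suc n"])
    then show ?thesis using Q A by simp
  qed
  have T: "transpose_mat (Q * R) = transpose_mat R * Q"
    using Q R by (subst transpose_mult) auto
  show ?case
  proof (intro exI conjI)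
    show "Q * R \<in> carrier_mat (Suc n) (Suc n)" using Q R by simp
    have "transpose_mat (Q * R) * (Q * R) = transpose_mat R * (Q * Q) * R"
      unfolding T using Q(1) R by (simp add: assoc_mult_mat[of _ "Suc n" "Suc n" _ "Suc n" _ "Suc n"])
    then show "transpose_mat (Q * R) * (Q * R) = 1\<^sub>m (Suc n)" using Q R RR by simp
    have "Q * R * L * transpose_mat (Q * R) = Q * (R * L * transpose_mat R) * Q"
      unfolding T using Q(1) R Lc by (simp add: assoc_mult_mat[of _ "Suc n" "Suc n" _ "Suc n" _ "Suc n"])
    then show "A = Q * R * mat_diag (Suc n) (\<lambda>i. case i of 0 \<Rightarrow> k | Suc j \<Rightarrow> l j) * transpose_mat (Q * R)"
      using QMQ \<open>R * L * transpose_mat R = M\<close> unfolding L_def by simp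
  qed
qed

subsection \<open>Comparison of the two Gaussian divergences\<close>

text \<open>The left side is twice the divergence of \<open>N(0, l)\<close> from
  \<open>N(0, 1)\<close>, the bracket on the right is twice the divergence in the opposite order.
  For large \<open>l\<close> the former grows like \<open>l\<close> and the latter like
  \<open>ln l\<close>, so the factor has to depend on an upper bound for \<open>l\<close>.\<close>

lemma kl_scalar_comparison:
  fixes M l :: real
  assumes "1 \<le> M" "0 < l" "l \<le> M"
  shows "l - 1 - ln l \<le> M * (1 / l - 1 + ln l)"
proof -
  \<comment> \<open>The derivative of the gap \<open>G\<close> changes sign only at 1 and at \<open>M\<close>, so \<open>G\<close> is minimal at 1 on \<open>(0, M]\<close>.\<close>
  define G where "G x = M * (1 / x - 1 + ln x) - (x - 1 - ln x)" for x
  have der: "(G has_real_derivative (M / x - 1) * (1 - 1 / x)) (at x)" if "0 < x" for x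
    unfolding G_def using that
    by (auto intro!: derivative_eq_intros simp: field_simps power2_eq_square)
  \<comment> \<open>\<open>G 1 = 0\<close>, so this is the claim.\<close>
  have "G 1 \<le> G l"
  proof (cases "l \<le> 1")
    case True
    show ?thesis
    proof (rule DERIV_nonpos_imp_nonincreasing[OF True])
      fix x assume x: "l \<le> x" "x \<le> 1"
      then have "0 < x" "x \<le> M" using assms by auto
      then have "(M / x - 1) * (1 - 1 / x) \<le> 0"
        using x by (intro mult_nonneg_nonpos) (auto simp: field_simps)
      then show "\<exists>y. (G has_real_derivative y) (at x) \<and> y \<le> 0" using der[OF \<open>0 < x\<close>] by blast
    qed
  next
    case False
    then have "1 \<le> l" by simp
    then show ?thesis
    proof (rule DERIV_nonneg_imp_nondecreasing)
      fix x assume x: "1 \<le> x" "x \<le> l"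
      then have "0 < x" "x \<le> M" using assms by auto
      then have "0 \<le> (M / x - 1) * (1 - 1 / x)"
        using x by (intro mult_nonneg_nonneg) (auto simp: field_simps)
      then show "\<exists>y. (G has_real_derivative y) (at x) \<and> 0 \<le> y" using der[OF \<open>0 < x\<close>] by blast
    qed
  qed
  then show ?thesis by (simp add: G_def)
qed

lemma kl_scalar_nonneg: "0 < l \<Longrightarrow> 0 \<le> 1 / l - 1 + ln (l::real)"
  using ln_le_minus_one[of "1 / l"] by (simp add: ln_div)

text \<open>All summands in the hypothesis are nonnegative, so each one is at most \<open>C\<close>.
  Hence \<open>ln (l i) \<le> C + 1 - 1 / l i \<le> C + 1\<close>, and \<open>exp (C + 1)\<close>
  bounds every \<open>l i\<close>, whatever the dimension. With this bound as the factor, both sums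
  compare term by term.\<close>

lemma kl_sum_comparison:
  fixes l v :: "nat \<Rightarrow> real"
  assumes l: "\<And>i. i < d \<Longrightarrow> 0 < l i" and C: "0 \<le> C"
    and le: "(\<Sum>i<d. 1 / l i - 1 + ln (l i)) + (\<Sum>i<d. (v i)\<^sup>2 / l i) \<le> C"
  shows "(\<Sum>i<d. l i - 1 - ln (l i)) + (\<Sum>i<d. (v i)\<^sup>2) \<le> exp (C + 1) * C"
proof -
  let ?M = "exp (C + 1)"
  have M: "1 \<le> ?M" using C by simp
  have lM: "l i \<le> ?M" if i: "i < d" for i
  proof -
    have "0 \<le> (\<Sum>i<d. (v i)\<^sup>2 / l i)" using l by (intro sum_nonneg) (auto simp: less_imp_le)
    moreover have "1 / l i - 1 + ln (l i) \<le> (\<Sum>i<d. 1 / l i - 1 + ln (l i))"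
      using i l kl_scalar_nonneg by (intro member_le_sum) auto
    ultimately have "ln (l i) \<le> C + 1 - 1 / l i" using le by linarith
    also have "\<dots> \<le> C + 1" using l[OF i] by simp
    finally have "exp (ln (l i)) \<le> ?M" by simp
    then show ?thesis using l[OF i] by simp
  qed
  have "(v i)\<^sup>2 \<le> ?M * ((v i)\<^sup>2 / l i)" if i: "i < d" for i
  proof -
    have "(v i)\<^sup>2 * l i \<le> (v i)\<^sup>2 * ?M" using lM[OF i] by (intro mult_left_mono) auto
    then show ?thesis using l[OF i] by (simp add: field_simps)
  qed
  moreover have "l i - 1 - ln (l i) \<le> ?M * (1 / l i - 1 + ln (l i))" if "i < d" for i
    using kl_scalar_comparison[OF M l lM] that by blast
  ultimately have "(\<Sum>i<d. l i - 1 - ln (l i)) + (\<Sum>i<d. (v i)\<^sup>2)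
      \<le> (\<Sum>i<d. ?M * (1 / l i - 1 + ln (l i))) + (\<Sum>i<d. ?M * ((v i)\<^sup>2 / l i))"
    by (intro add_mono sum_mono) auto
  also have "\<dots> = ?M * ((\<Sum>i<d. 1 / l i - 1 + ln (l i)) + (\<Sum>i<d. (v i)\<^sup>2 / l i))"
    by (simp only: sum_distrib_left distrib_left)
  also have "\<dots> \<le> ?M * C" using le by (intro mult_left_mono) auto
  finally show ?thesis .
qed

section \<open>Trace, quadratic form, inverse and determinant in an orthonormal eigenbasis\<close>

lemma mat_diag_conj:
  fixes P :: "real mat"
  assumes P: "P \<in> carrier_mat n n" and i: "i < n" and j: "j < n"
  shows "(P * mat_diag n f * transpose_mat P) $$ (i,j) = (\<Sum>k<n. f k * (P $$ (i,k) * P $$ (j,k)))"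
  using assms by (simp add: mat_diag_mult_right[OF P] scalar_prod_def atLeast0LessThan ac_simps)

lemma mat_diag_conj_trace:
  fixes P :: "real mat"
  assumes P: "P \<in> carrier_mat n n" "transpose_mat P * P = 1\<^sub>m n"
  shows "(\<Sum>i<n. (P * mat_diag n f * transpose_mat P) $$ (i,i)) = (\<Sum>k<n. f k)"
proof -
  have orth: "(\<Sum>i<n. P $$ (i,k) * P $$ (i,k)) = 1" if "k < n" for k
    using arg_cong[OF P(2), of "\<lambda>M. M $$ (k,k)"] P(1) that
    by (simp add: scalar_prod_def atLeast0LessThan)
  have "(\<Sum>i<n. (P * mat_diag n f * transpose_mat P) $$ (i,i)) =
      (\<Sum>i<n. \<Sum>k<n. f k * (P $$ (i,k) * P $$ (i,k)))"
    using mat_diag_conj[OF P(1)] by simp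
  also have "\<dots> = (\<Sum>k<n. f k * (\<Sum>i<n. P $$ (i,k) * P $$ (i,k)))"
    by (subst sum.swap) (simp add: sum_distrib_left)
  finally show ?thesis using orth by simp
qed

lemma mat_diag_conj_quadratic_form:
  fixes P :: "real mat"
  assumes P: "P \<in> carrier_mat n n" and v: "v \<in> carrier_vec n"
  shows "scalar_prod v ((P * mat_diag n f * transpose_mat P) *\<^sub>v v) =
    (\<Sum>k<n. (scalar_prod (col P k) v)\<^sup>2 * f k)"
proof -
  let ?F = "\<lambda>i j k. f k * (P $$ (i,k) * vec_index v i) * (P $$ (j,k) * vec_index v j)"
  have "scalar_prod v ((P * mat_diag n f * transpose_mat P) *\<^sub>v v) =
      (\<Sum>i<n. vec_index v i * (\<Sum>j<n. (P * mat_diag n f * transpose_mat P) $$ (i,j) * vec_index v j))"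
    using v P by (simp add: scalar_prod_def atLeast0LessThan)
  also have "\<dots> = (\<Sum>i<n. \<Sum>j<n. \<Sum>k<n. ?F i j k)"
    unfolding sum_distrib_left
    by (intro sum.cong refl) (simp add: mat_diag_conj[OF P] sum_distrib_left sum_distrib_right mult_ac)
  also have "\<dots> = (\<Sum>i<n. \<Sum>k<n. \<Sum>j<n. ?F i j k)" by (intro sum.cong refl sum.swap)
  also have "\<dots> = (\<Sum>k<n. \<Sum>i<n. \<Sum>j<n. ?F i j k)" by (rule sum.swap)
  also have "\<dots> = (\<Sum>k<n. (\<Sum>i<n. P $$ (i,k) * vec_index v i)\<^sup>2 * f k)"
    unfolding power2_eq_square sum_product unfolding sum_distrib_right by (intro sum.cong refl) (simp add: mult_ac)
  finally show ?thesis using P v by (simp add: scalar_prod_def atLeast0LessThan)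
qed

text \<open>Evaluating the quadratic form at a column of \<open>P\<close> returns the corresponding
  eigenvalue, which is therefore positive. Inverting the eigenvalues gives a two-sided inverse of
  \<open>S\<close>, and uniqueness of inverses identifies it with the result of
  \<open>mat_inverse\<close>.\<close>

lemma pos_def_mat_spectral:
  fixes S :: "real mat"
  assumes S: "S \<in> carrier_mat n n" "transpose_mat S = S"
    and pd: "\<And>v. v \<in> carrier_vec n \<Longrightarrow> v \<noteq> 0\<^sub>v n \<Longrightarrow> 0 < scalar_prod v (S *\<^sub>v v)"
  obtains P l where "P \<in> carrier_mat n n" "transpose_mat P * P = 1\<^sub>m n" "P * transpose_mat P = 1\<^sub>m n"
    "\<And>i. i < n \<Longrightarrow> 0 < l i" "S = P * mat_diag n l * transpose_mat P"
    "mat_inverse S = Some (P * mat_diag n (\<lambda>i. 1 / l i) * transpose_mat P)"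
    "Determinant.det S = (\<Prod>i<n. l i)"
proof -
  obtain P l where P: "P \<in> carrier_mat n n" "transpose_mat P * P = 1\<^sub>m n"
    and SP: "S = P * mat_diag n l * transpose_mat P"
    using real_symmetric_diagonalization[OF S] by blast
  have PP: "P * transpose_mat P = 1\<^sub>m n"
    using mat_mult_left_right_inverse[OF _ P(1,2)] P(1) by simp
  have orth: "scalar_prod (col P k) (col P i) = (if k = i then 1 else 0)" if "k < n" "i < n" for k i
    using arg_cong[OF P(2), of "\<lambda>M. M $$ (k,i)"] P(1) that by simp
  have l: "0 < l i" if i: "i < n" for i
  proof -
    have c: "col P i \<in> carrier_vec n" using P(1) i by auto
    have "col P i \<noteq> 0\<^sub>v n" using orth[OF i i] c by auto
    from pd[OF c this] have "0 < (\<Sum>k<n. (if k = i then 1 else 0)\<^sup>2 * l k)"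
      unfolding SP mat_diag_conj_quadratic_form[OF P(1) c] using orth i by simp
    also have "\<dots> = (\<Sum>k<n. if k = i then l k else 0)" by (intro sum.cong) auto
    finally show ?thesis using i by simp
  qed
  define B where "B = P * mat_diag n (\<lambda>i. 1 / l i) * transpose_mat P"
  have Bc: "B \<in> carrier_mat n n" using P mult_carrier_mat[OF P(1) mat_diag_dim]
    unfolding B_def by (intro mult_carrier_mat[of _ n n]) auto
  have prod: "P * mat_diag n f * transpose_mat P * (P * mat_diag n g * transpose_mat P) = 1\<^sub>m n"
    if "\<And>i. i < n \<Longrightarrow> f i * g i = 1" for f g
  proof -
    have fg: "mat_diag n f * mat_diag n g = 1\<^sub>m n"
      unfolding mat_diag_diag using that by (auto simp: mat_diag_def intro!: eq_matI)
    note [simp] = mult_carrier_mat[of _ n n _ n] mat_diag_dim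
    note as = assoc_mult_mat[of _ n n _ n _ n]
    have "P * mat_diag n f * transpose_mat P * (P * mat_diag n g * transpose_mat P)
        = P * (mat_diag n f * ((transpose_mat P * P) * (mat_diag n g * transpose_mat P)))"
      using P(1) by (simp add: as del: mat_diag_diag)
    also have "\<dots> = P * ((mat_diag n f * mat_diag n g) * transpose_mat P)"
      using P by (simp add: as left_mult_one_mat[of _ n n] del: mat_diag_diag)
    also have "\<dots> = 1\<^sub>m n" unfolding fg using P PP by simp
    finally show ?thesis .
  qed
  have SB: "S * B = 1\<^sub>m n" and BS: "B * S = 1\<^sub>m n"
    unfolding SP B_def by (rule prod, use l in fastforce)+
  \<comment> \<open>\<open>mat_inverse\<close> can return \<open>None\<close> only outside the units
    of the matrix ring.\<close>
  have "S \<in> Units (ring_mat TYPE(real) n ())"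
    using S(1) Bc SB BS by (auto simp: Units_def ring_mat_def)
  then obtain B' where B': "mat_inverse S = Some B'"
    using mat_inverse(1)[OF S(1)] by fastforce
  from mat_inverse(2)[OF S(1) this] have "S * B' = 1\<^sub>m n" "B' \<in> carrier_mat n n" by auto
  then have "B' = B * S * B'" using BS by simp
  also have "\<dots> = B * (S * B')" using Bc S \<open>B' \<in> carrier_mat n n\<close> by simp
  also have "\<dots> = B" using Bc \<open>S * B' = 1\<^sub>m n\<close> by simp
  finally have inv: "mat_inverse S = Some B" using B' by simp
  have "Determinant.det S = Determinant.det P * Determinant.det (mat_diag n l) * Determinant.det (transpose_mat P)"
    unfolding SP using P mat_diag_dim[of n l] by (simp add: Determinant.det_mult[of _ n])
  also have "\<dots> = Determinant.det (P * transpose_mat P) * Determinant.det (mat_diag n l)"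
    using P by (simp add: Determinant.det_mult[of _ n])
  also have "\<dots> = Determinant.det (mat_diag n l)" by (simp add: PP)
  also have "\<dots> = (\<Prod>i<n. l i)"
    by (subst det_upper_triangular[of _ n])
       (auto simp: mat_diag_def diag_mat_def prod.list_conv_set_nth atLeast0LessThan)
  finally have det: "Determinant.det S = (\<Prod>i<n. l i)" .
  show thesis using that[OF P PP l SP inv[unfolded B_def] det] .
qed

text \<open>The hypothesis bounds \<open>2 D(N(0,1) || N(m,S))\<close> and the conclusion bounds
  \<open>2 D(N(m,S) || N(0,1))\<close>, with 1 the identity matrix. In an eigenbasis of
  \<open>S\<close>, where \<open>w\<close> holds the coordinates of \<open>m\<close>, this is
  \<open>kl_sum_comparison\<close>.\<close>

lemma gauss_kl_matrix_comparison:
  fixes S :: "real mat"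
  assumes S: "S \<in> carrier_mat d d" "transpose_mat S = S"
    and pd: "\<And>v. v \<in> carrier_vec d \<Longrightarrow> v \<noteq> 0\<^sub>v d \<Longrightarrow> 0 < scalar_prod v (S *\<^sub>v v)"
    and m: "m \<in> carrier_vec d" and C: "0 \<le> C"
    and le: "(\<Sum>i<d. the (mat_inverse S) $$ (i,i)) - d + ln (Determinant.det S)
       + scalar_prod m (the (mat_inverse S) *\<^sub>v m) \<le> C"
  shows "(\<Sum>i<d. S $$ (i,i)) - d - ln (Determinant.det S) + scalar_prod m m \<le> exp (C + 1) * C"
proof -
  obtain P l where P: "P \<in> carrier_mat d d" "transpose_mat P * P = 1\<^sub>m d" "P * transpose_mat P = 1\<^sub>m d"
    and l: "\<And>i. i < d \<Longrightarrow> 0 < l i" and SP: "S = P * mat_diag d l * transpose_mat P"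
    and inv: "mat_inverse S = Some (P * mat_diag d (\<lambda>i. 1 / l i) * transpose_mat P)"
    and det: "Determinant.det S = (\<Prod>i<d. l i)"
    by (rule pos_def_mat_spectral[OF S pd]) auto
  define w where "w k = scalar_prod (col P k) m" for k
  have lndet: "ln (Determinant.det S) = (\<Sum>i<d. ln (l i))"
    unfolding det using l by (subst ln_prod) force+
  have "P * mat_diag d (\<lambda>_. 1) * transpose_mat P = 1\<^sub>m d" using P by simp
  then have mm: "scalar_prod m m = (\<Sum>k<d. (w k)\<^sup>2)"
    using mat_diag_conj_quadratic_form[OF P(1) m, of "\<lambda>_. 1"] m by (simp add: w_def)
  have "(\<Sum>i<d. 1 / l i - 1 + ln (l i)) + (\<Sum>i<d. (w i)\<^sup>2 / l i) \<le> C"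
    using le unfolding lndet inv option.sel mat_diag_conj_trace[OF P(1,2)] mat_diag_conj_quadratic_form[OF P(1) m]
    by (simp add: w_def sum.distrib sum_subtractf)
  from kl_sum_comparison[OF l C this] show ?thesis
    unfolding lndet mm by (subst SP, subst mat_diag_conj_trace[OF P(1,2)]) (simp add: sum_subtractf)
qed

subsection \<open>Moments of the standard Gaussian\<close>

lemma measurable_lebesgue_Rn_component:
  "(\<lambda>x. x i) \<in> borel_measurable (lebesgue_Rn d)"
proof (cases "i < d")
  case True
  then have "(\<lambda>x. x i) \<in> borel_measurable (Pi\<^sub>M {..<d} (\<lambda>_. lborel :: real measure))"
    using measurable_component_singleton[of i "{..<d}" "\<lambda>_. lborel :: real measure"] by simp
  then show ?thesis unfolding lebesgue_Rn_def by (rule measurable_completion)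
next
  case False
  \<comment> \<open>Points of the product space are extensional functions, so a coordinate outside
    the index set is the constant \<open>undefined\<close>.\<close>
  then have "x i = undefined" if "x \<in> space (lebesgue_Rn d)" for x
    using that by (auto simp: lebesgue_Rn_def space_PiM PiE_def extensional_def)
  then show ?thesis by (subst measurable_cong[of _ _ "\<lambda>_. undefined"]) auto
qed

lemma measurable_std_gauss [measurable]: "std_gauss d \<in> borel_measurable (lebesgue_Rn d)"
  using measurable_lebesgue_Rn_component by (simp add: std_gauss_def[abs_def])

lemma std_gauss_pos: "0 < std_gauss d x"
  unfolding std_gauss_def by (intro prod_pos) (simp add: normal_density_pos)

text \<open>Fubini on the product measure. The integrand is measurable already before completion, so
  completing changes neither integrability nor the integral.\<close>

lemma
  fixes g :: "nat \<Rightarrow> real \<Rightarrow> real"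
  assumes "\<And>i. i < d \<Longrightarrow> integrable lborel (g i)"
  shows integrable_lebesgue_Rn_prod: "integrable (lebesgue_Rn d) (\<lambda>x. \<Prod>i<d. g i (x i))"
    and integral_lebesgue_Rn_prod: "(LINT x|lebesgue_Rn d. (\<Prod>i<d. g i (x i))) =
      (\<Prod>i<d. (LINT x|lborel. g i x))"
proof -
  interpret product_sigma_finite "\<lambda>_::nat. lborel :: real measure" by standard
  have int: "integrable (Pi\<^sub>M {..<d} (\<lambda>_. lborel)) (\<lambda>x. \<Prod>i<d. g i (x i))"
    using assms by (intro product_integrable_prod) auto
  then have meas: "(\<lambda>x. \<Prod>i<d. g i (x i)) \<in> borel_measurable (Pi\<^sub>M {..<d} (\<lambda>_. lborel))" by simp
  show "integrable (lebesgue_Rn d) (\<lambda>x. \<Prod>i<d. g i (x i))"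
    unfolding lebesgue_Rn_def using int meas by (simp add: integrable_completion)
  show "(LINT x|lebesgue_Rn d. (\<Prod>i<d. g i (x i))) =
      (\<Prod>i<d. (LINT x|lborel. g i x))"
    unfolding lebesgue_Rn_def using assms
    by (subst integral_completion[OF meas], subst product_integral_prod) auto
qed

lemma
  shows integrable_std_gauss: "integrable (lebesgue_Rn d) (std_gauss d)"
    and integral_std_gauss: "(LINT x|lebesgue_Rn d. std_gauss d x) = 1"
  unfolding std_gauss_def[abs_def]
  by (auto simp: integral_lebesgue_Rn_prod[where g="\<lambda>_. std_normal_density"]
      intro!: integrable_lebesgue_Rn_prod)

lemma
  assumes i: "i < d"
  shows integrable_std_gauss_moment1: "integrable (lebesgue_Rn d) (\<lambda>x. x i * std_gauss d x)"
    and integral_std_gauss_moment1: "(LINT x|lebesgue_Rn d. x i * std_gauss d x) = 0"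
proof -
  let ?g = "\<lambda>k y. std_normal_density y * (if k = i then y else 1)"
  have int: "integrable lborel (?g k)" for k
    using integrable_std_normal_moment[of 1] by (cases "k = i") simp_all
  have eq: "(\<lambda>x. x i * std_gauss d x) = (\<lambda>x. \<Prod>k<d. ?g k (x k))"
    using i by (auto simp: std_gauss_def prod.distrib prod.delta mult.commute)
  show "integrable (lebesgue_Rn d) (\<lambda>x. x i * std_gauss d x)"
    unfolding eq using int by (rule integrable_lebesgue_Rn_prod)
  show "(LINT x|lebesgue_Rn d. x i * std_gauss d x) = 0"
    unfolding eq integral_lebesgue_Rn_prod[OF int]
    using i integral_std_normal_moment_odd[of 0] by (intro prod_zero bexI[of _ i]) auto
qed

lemma
  assumes i: "i < d" and j: "j < d"
  shows integrable_std_gauss_moment2: "integrable (lebesgue_Rn d) (\<lambda>x. x i * x j * std_gauss d x)"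
    and integral_std_gauss_moment2:
      "(LINT x|lebesgue_Rn d. x i * x j * std_gauss d x) = (if i = j then 1 else 0)"
proof -
  \<comment> \<open>The two conditionals are separate factors so that \<open>i = j\<close> produces
    the square \<open>y^2\<close> in a single coordinate.\<close>
  let ?g = "\<lambda>k y. std_normal_density y * ((if k = i then y else 1) * (if k = j then y else 1))"
  note m1 = integrable_std_normal_moment[of 1] integral_std_normal_moment_odd[of 0]
  note m2 = integrable_std_normal_moment[of 2] integral_std_normal_moment_even[of 1]
  have int: "integrable lborel (?g k)" for k
    using m1 m2 by (cases "k = i"; cases "k = j") (simp_all add: power2_eq_square)
  have eq: "(\<lambda>x. x i * x j * std_gauss d x) = (\<lambda>x. \<Prod>k<d. ?g k (x k))"
    using i j by (auto simp: std_gauss_def prod.distrib prod.delta ac_simps)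
  show "integrable (lebesgue_Rn d) (\<lambda>x. x i * x j * std_gauss d x)"
    unfolding eq using int by (rule integrable_lebesgue_Rn_prod)
  show "(LINT x|lebesgue_Rn d. x i * x j * std_gauss d x) = (if i = j then 1 else 0)"
  proof (cases "i = j")
    case True
    have "(LINT y|lborel. ?g k y) = 1" for k
      using m2 True by (cases "k = i") (simp_all add: power2_eq_square)
    then show ?thesis unfolding eq integral_lebesgue_Rn_prod[OF int] using True by simp
  next
    case False
    then have "(LINT y|lborel. ?g i y) = 0" using m1 by simp
    then have "(\<Prod>k<d. (LINT y|lborel. ?g k y)) = 0"
      using i by (intro prod_zero bexI[of _ i]) auto
    then show ?thesis unfolding eq integral_lebesgue_Rn_prod[OF int] using False by simp
  qed
qed

text \<open>Integrate first along coordinate \<open>i\<close>: with the other coordinates fixed, a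
  line in this direction meets the hyperplane in the single point \<open>?y\<close>, which is a null
  set.\<close>

lemma AE_not_in_hyperplane:
  assumes i: "i < d" and a: "a i \<noteq> 0"
  shows "AE x in lebesgue_Rn d. (\<Sum>k<d. a k * x k) \<noteq> c"
proof -
  let ?M = "\<lambda>_::nat. lborel :: real measure"
  interpret product_sigma_finite ?M by standard
  let ?I = "{..<d} - {i}"
  have I: "insert i ?I = {..<d}" using i by auto
  let ?f = "\<lambda>x. indicator {c} (\<Sum>k<d. a k * x k) :: ennreal"
  have meas: "?f \<in> borel_measurable (Pi\<^sub>M {..<d} ?M)" by measurable
  have "(\<integral>\<^sup>+x. ?f x \<partial>Pi\<^sub>M {..<d} ?M) = (\<integral>\<^sup>+x. (\<integral>\<^sup>+y. ?f (x(i := y)) \<partial>lborel) \<partial>Pi\<^sub>M ?I ?M)"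
    using product_nn_integral_insert[of ?I i ?f] meas unfolding I by simp
  also have "\<dots> = (\<integral>\<^sup>+x. 0 \<partial>Pi\<^sub>M ?I ?M)"
  proof (intro nn_integral_cong)
    fix x
    let ?y = "(c - (\<Sum>k\<in>?I. a k * x k)) / a i"
    have "?f (x(i := y)) = indicator {?y} y" for y
    proof -
      have "(\<Sum>k<d. a k * (x(i := y)) k) = a i * y + (\<Sum>k\<in>?I. a k * x k)"
        using i by (subst sum.remove[of _ i]) (auto intro!: sum.cong)
      then show ?thesis using a by (auto simp: indicator_def field_simps)
    qed
    then show "(\<integral>\<^sup>+y. ?f (x(i := y)) \<partial>lborel) = 0" by simp
  qed
  finally have "(\<integral>\<^sup>+x. ?f x \<partial>Pi\<^sub>M {..<d} ?M) = 0" by simp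
  then have "AE x in Pi\<^sub>M {..<d} ?M. ?f x = 0"
    using nn_integral_0_iff_AE[OF meas] by simp
  then have "AE x in lebesgue_Rn d. ?f x = 0"
    unfolding lebesgue_Rn_def by (rule AE_completion)
  then show ?thesis by eventually_elim (auto simp: indicator_def split: if_splits)
qed

subsection \<open>Divergences from the Gaussian projection\<close>

lemma quadratic_form_sum:
  fixes B :: "real mat"
  assumes "B \<in> carrier_mat d d" "v \<in> carrier_vec d"
  shows "scalar_prod v (B *\<^sub>v v) = (\<Sum>i<d. \<Sum>j<d. B $$ (i,j) * (vec_index v i * vec_index v j))"
  using assms by (simp add: scalar_prod_def atLeast0LessThan sum_distrib_left mult_ac)

lemma centered_quadratic_form_sum:
  fixes B :: "real mat"
  assumes "B \<in> carrier_mat d d" "m \<in> carrier_vec d"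
  shows "scalar_prod (vec d x - m) (B *\<^sub>v (vec d x - m)) =
    (\<Sum>i<d. \<Sum>j<d. B $$ (i,j) * ((x i - vec_index m i) * (x j - vec_index m j)))"
  using assms by (subst quadratic_form_sum[of _ d]) auto

lemma measurable_mv_normal_density:
  assumes B: "the (mat_inverse S) \<in> carrier_mat d d" and m: "m \<in> carrier_vec d"
  shows "mv_normal_density d m S \<in> borel_measurable (lebesgue_Rn d)"
proof -
  note [measurable] = measurable_lebesgue_Rn_component
  show ?thesis
    unfolding mv_normal_density_def[abs_def] centered_quadratic_form_sum[OF B m] by measurable
qed

text \<open>The powers of \<open>2 * pi\<close> in the two normalizations cancel. What remains is a
  polynomial of degree at most 2 in the coordinates, so its integral against a density depends only
  on the first two moments.\<close>

lemma ln_std_gauss_div_mv_normal: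
  assumes det: "0 < Determinant.det S"
  shows "ln (std_gauss d x / mv_normal_density d m S x) =
    (ln (Determinant.det S) - (\<Sum>i<d. x i * x i)
      + scalar_prod (vec d x - m) (the (mat_inverse S) *\<^sub>v (vec d x - m))) / 2"
proof -
  let ?q = "scalar_prod (vec d x - m) (the (mat_inverse S) *\<^sub>v (vec d x - m))"
  have "ln (std_gauss d x) = (\<Sum>i<d. ln (std_normal_density (x i)))"
    unfolding std_gauss_def by (subst ln_prod) (auto simp: normal_density_pos less_imp_neq[symmetric])
  also have "\<dots> = (\<Sum>i<d. - ln (2 * pi) / 2 - x i * x i / 2)"
    by (intro sum.cong refl) (simp add: std_normal_density_def ln_mult ln_div ln_sqrt power2_eq_square field_simps)
  also have "\<dots> = - real d * ln (2 * pi) / 2 - (\<Sum>i<d. x i * x i) / 2"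
    by (simp add: sum_subtractf sum_divide_distrib)
  finally have f: "ln (std_gauss d x) = - real d * ln (2 * pi) / 2 - (\<Sum>i<d. x i * x i) / 2" .
  define D where "D = (2 * pi) ^ d * Determinant.det S"
  have D: "0 < D" using det by (simp add: D_def)
  have lnD: "ln D = real d * ln (2 * pi) + ln (Determinant.det S)"
    unfolding D_def by (subst ln_mult_pos, simp, fact det, subst ln_realpow) simp_all
  have "mv_normal_density d m S x = 1 / sqrt D * exp (- ?q / 2)"
    by (simp add: mv_normal_density_def D_def)
  then have "ln (mv_normal_density d m S x) = - ln D / 2 - ?q / 2"
    using D by (simp add: ln_mult ln_div ln_sqrt)
  then have g: "ln (mv_normal_density d m S x) = - (real d * ln (2 * pi) + ln (Determinant.det S)) / 2 - ?q / 2"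
    unfolding lnD .
  have "0 < mv_normal_density d m S x" using det by (simp add: mv_normal_density_def)
  then have "ln (std_gauss d x / mv_normal_density d m S x) = ln (std_gauss d x) - ln (mv_normal_density d m S x)"
    using std_gauss_pos[of d x] by (simp add: ln_div)
  then show ?thesis unfolding f g by (simp add: field_simps)
qed

text \<open>Instantiated with both \<open>std_gauss d\<close> and \<open>cond_gauss d A\<close>, so
  that the two divergences come from one moment computation.\<close>

locale finite_second_moments =
  fixes d :: nat and h :: "(nat \<Rightarrow> real) \<Rightarrow> real"
  assumes integrable_density: "integrable (lebesgue_Rn d) h"
    and integral_density: "(LINT x|lebesgue_Rn d. h x) = 1"
    and integrable_first: "i < d \<Longrightarrow> integrable (lebesgue_Rn d) (\<lambda>x. x i * h x)"
    and integrable_second: "i < d \<Longrightarrow> j < d \<Longrightarrow> integrable (lebesgue_Rn d) (\<lambda>x. x i * x j * h x)"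
begin

lemma
  assumes i: "i < d" and j: "j < d"
  shows integrable_centered: "integrable (lebesgue_Rn d) (\<lambda>x. (x i - a) * (x j - b) * h x)"
    and integral_centered: "(LINT x|lebesgue_Rn d. (x i - a) * (x j - b) * h x) =
      (LINT x|lebesgue_Rn d. x i * x j * h x) - a * (LINT x|lebesgue_Rn d. x j * h x)
        - b * (LINT x|lebesgue_Rn d. x i * h x) + a * b"
proof -
  have eq: "(\<lambda>x. (x i - a) * (x j - b) * h x) =
      (\<lambda>x. x i * x j * h x - a * (x j * h x) - b * (x i * h x) + a * b * h x)"
    by (auto simp: algebra_simps)
  note int = integrable_density integrable_first[OF i] integrable_first[OF j] integrable_second[OF i j]
  show "integrable (lebesgue_Rn d) (\<lambda>x. (x i - a) * (x j - b) * h x)"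
    unfolding eq using int by auto
  show "(LINT x|lebesgue_Rn d. (x i - a) * (x j - b) * h x) =
      (LINT x|lebesgue_Rn d. x i * x j * h x) - a * (LINT x|lebesgue_Rn d. x j * h x)
        - b * (LINT x|lebesgue_Rn d. x i * h x) + a * b"
    unfolding eq using int by (simp add: integral_density)
qed

lemma
  fixes w :: "nat \<Rightarrow> nat \<Rightarrow> real" and a :: "nat \<Rightarrow> real"
  shows integrable_centered_quadratic: "integrable (lebesgue_Rn d)
      (\<lambda>x. \<Sum>i<d. \<Sum>j<d. w i j * ((x i - a i) * (x j - a j) * h x))"
    and integral_centered_quadratic:
      "(LINT x|lebesgue_Rn d. (\<Sum>i<d. \<Sum>j<d. w i j * ((x i - a i) * (x j - a j) * h x))) =
      (\<Sum>i<d. \<Sum>j<d. w i j * (LINT x|lebesgue_Rn d. (x i - a i) * (x j - a j) * h x))"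
proof -
  have int: "integrable (lebesgue_Rn d) (\<lambda>x. w i j * ((x i - a i) * (x j - a j) * h x))"
    if "i < d" "j < d" for i j
    using integrable_centered[OF that] by (rule integrable_mult_right)
  then have int': "integrable (lebesgue_Rn d) (\<lambda>x. \<Sum>j<d. w i j * ((x i - a i) * (x j - a j) * h x))"
    if "i < d" for i
    using that by (intro Bochner_Integration.integrable_sum) auto
  then show "integrable (lebesgue_Rn d) (\<lambda>x. \<Sum>i<d. \<Sum>j<d. w i j * ((x i - a i) * (x j - a j) * h x))"
    by (intro Bochner_Integration.integrable_sum int') simp
  have "(LINT x|lebesgue_Rn d. (\<Sum>i<d. \<Sum>j<d. w i j * ((x i - a i) * (x j - a j) * h x))) =
      (\<Sum>i<d. LINT x|lebesgue_Rn d. (\<Sum>j<d. w i j * ((x i - a i) * (x j - a j) * h x)))"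
    using int' by (intro Bochner_Integration.integral_sum) auto
  also have "\<dots> = (\<Sum>i<d. \<Sum>j<d. LINT x|lebesgue_Rn d. w i j * ((x i - a i) * (x j - a j) * h x))"
    using int by (intro sum.cong refl Bochner_Integration.integral_sum) auto
  finally show "(LINT x|lebesgue_Rn d. (\<Sum>i<d. \<Sum>j<d. w i j * ((x i - a i) * (x j - a j) * h x))) =
      (\<Sum>i<d. \<Sum>j<d. w i j * (LINT x|lebesgue_Rn d. (x i - a i) * (x j - a j) * h x))"
    by simp
qed

text \<open>Here \<open>m\<close> and \<open>S\<close> are not tied to the moments of
  \<open>h\<close>: the formula applies to \<open>cond_gauss d A\<close>, whose moments they will
  be, and equally to \<open>std_gauss d\<close>.\<close>

lemma
  assumes det: "0 < Determinant.det S" and B: "the (mat_inverse S) \<in> carrier_mat d d"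
    and m: "m \<in> carrier_vec d"
  defines "L \<equiv> \<lambda>x. h x * ln (std_gauss d x / mv_normal_density d m S x)"
  shows integrable_ln_std_gauss_div_mv_normal: "integrable (lebesgue_Rn d) L"
    and integral_ln_std_gauss_div_mv_normal: "(LINT x|lebesgue_Rn d. L x) =
      (ln (Determinant.det S) - (\<Sum>i<d. LINT x|lebesgue_Rn d. x i * x i * h x)
        + (\<Sum>i<d. \<Sum>j<d. the (mat_inverse S) $$ (i,j) *
            (LINT x|lebesgue_Rn d. (x i - vec_index m i) * (x j - vec_index m j) * h x))) / 2"
proof -
  have "L x = (ln (Determinant.det S) * h x - (\<Sum>i<d. x i * x i * h x)
      + (\<Sum>i<d. \<Sum>j<d. the (mat_inverse S) $$ (i,j) *
          ((x i - vec_index m i) * (x j - vec_index m j) * h x))) / 2" for x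
    unfolding L_def ln_std_gauss_div_mv_normal[OF det] centered_quadratic_form_sum[OF B m]
    by (simp add: distrib_left right_diff_distrib sum_distrib_left add_divide_distrib diff_divide_distrib mult_ac)
  then have eq: "L = (\<lambda>x. (ln (Determinant.det S) * h x - (\<Sum>i<d. x i * x i * h x)
      + (\<Sum>i<d. \<Sum>j<d. the (mat_inverse S) $$ (i,j) *
          ((x i - vec_index m i) * (x j - vec_index m j) * h x))) / 2)" by blast
  note int2 = integrable_centered_quadratic[of "\<lambda>i j. the (mat_inverse S) $$ (i,j)" "vec_index m"]
  have int1: "integrable (lebesgue_Rn d) (\<lambda>x. \<Sum>i<d. x i * x i * h x)"
    using integrable_second by (intro Bochner_Integration.integrable_sum) auto
  show "integrable (lebesgue_Rn d) L"
    unfolding eq using integrable_density int1 int2 by simp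
  have "(LINT x|lebesgue_Rn d. L x) = (ln (Determinant.det S) - (LINT x|lebesgue_Rn d. (\<Sum>i<d. x i * x i * h x))
      + (LINT x|lebesgue_Rn d. (\<Sum>i<d. \<Sum>j<d. the (mat_inverse S) $$ (i,j) *
          ((x i - vec_index m i) * (x j - vec_index m j) * h x)))) / 2"
    unfolding eq using integrable_density int1 int2 by (simp add: integral_density)
  also have "(LINT x|lebesgue_Rn d. (\<Sum>i<d. x i * x i * h x)) = (\<Sum>i<d. LINT x|lebesgue_Rn d. x i * x i * h x)"
    using integrable_second by (intro Bochner_Integration.integral_sum) auto
  also have "(LINT x|lebesgue_Rn d. (\<Sum>i<d. \<Sum>j<d. the (mat_inverse S) $$ (i,j) *
          ((x i - vec_index m i) * (x j - vec_index m j) * h x))) =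
      (\<Sum>i<d. \<Sum>j<d. the (mat_inverse S) $$ (i,j) *
          (LINT x|lebesgue_Rn d. (x i - vec_index m i) * (x j - vec_index m j) * h x))"
    by (rule integral_centered_quadratic)
  finally show "(LINT x|lebesgue_Rn d. L x) =
      (ln (Determinant.det S) - (\<Sum>i<d. LINT x|lebesgue_Rn d. x i * x i * h x)
        + (\<Sum>i<d. \<Sum>j<d. the (mat_inverse S) $$ (i,j) *
            (LINT x|lebesgue_Rn d. (x i - vec_index m i) * (x j - vec_index m j) * h x))) / 2" .
qed

lemma mean_vec_carrier: "mean_vec d h \<in> carrier_vec d"
  by (simp add: mean_vec_def)

lemma cov_mat_carrier: "cov_mat d h \<in> carrier_mat d d"
  by (simp add: cov_mat_def)

lemma transpose_cov_mat: "transpose_mat (cov_mat d h) = cov_mat d h"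
  by (auto intro!: eq_matI Bochner_Integration.integral_cong simp: cov_mat_def)

text \<open>The quadratic form at \<open>v\<close> is the integral of
  \<open>(v . (x - mean))^2 * h x\<close>. If it vanished, \<open>h\<close> would be zero almost
  everywhere off a hyperplane, which is itself a null set, contradicting total mass 1.\<close>

lemma cov_mat_pos_def:
  assumes nonneg: "\<And>x. 0 \<le> h x" and v: "v \<in> carrier_vec d" "v \<noteq> 0\<^sub>v d"
  shows "0 < scalar_prod v (cov_mat d h *\<^sub>v v)"
proof -
  let ?m = "vec_index (mean_vec d h)" and ?v = "vec_index v"
  define F where "F x = (\<Sum>i<d. \<Sum>j<d. ?v i * ?v j * ((x i - ?m i) * (x j - ?m j) * h x))" for x
  have F: "F x = (\<Sum>i<d. ?v i * (x i - ?m i))\<^sup>2 * h x" for x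
    unfolding F_def power2_eq_square sum_product unfolding sum_distrib_right
    by (intro sum.cong refl) (simp add: mult_ac)
  have intF: "integrable (lebesgue_Rn d) F"
    unfolding F_def by (rule integrable_centered_quadratic)
  have "scalar_prod v (cov_mat d h *\<^sub>v v) = (LINT x|lebesgue_Rn d. F x)"
    unfolding F_def quadratic_form_sum[OF cov_mat_carrier v(1)] integral_centered_quadratic
    by (simp add: cov_mat_def mult.commute)
  moreover have "(LINT x|lebesgue_Rn d. F x) \<noteq> 0"
  proof
    assume "(LINT x|lebesgue_Rn d. F x) = 0"
    moreover have "AE x in lebesgue_Rn d. 0 \<le> F x" using nonneg by (simp add: F)
    ultimately have "AE x in lebesgue_Rn d. F x = 0"
      using integral_nonneg_eq_0_iff_AE[OF intF] by simp
    moreover obtain i where i: "i < d" "?v i \<noteq> 0" using v by (auto simp: vec_eq_iff)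
    have "AE x in lebesgue_Rn d. (\<Sum>k<d. ?v k * x k) \<noteq> (\<Sum>k<d. ?v k * ?m k)"
      using i by (rule AE_not_in_hyperplane)
    ultimately have "AE x in lebesgue_Rn d. h x = 0"
      by eventually_elim (auto simp: F algebra_simps sum_subtractf)
    then have "(LINT x|lebesgue_Rn d. h x) = 0" by (rule integral_eq_zero_AE)
    then show False by (simp add: integral_density)
  qed
  moreover have "0 \<le> (LINT x|lebesgue_Rn d. F x)"
    using nonneg by (intro Bochner_Integration.integral_nonneg) (simp add: F)
  ultimately show ?thesis by simp
qed

end

section \<open>The Gaussian, its restriction, and the lower bound on the probability\<close>

lemma std_gauss_second_moments: "finite_second_moments d (std_gauss d)"
  by unfold_locales
     (auto simp: integrable_std_gauss integral_std_gauss integrable_std_gauss_moment1 integrable_std_gauss_moment2)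

lemma cond_gauss_second_moments:
  assumes A: "A \<in> sets (lebesgue_Rn d)" and p: "0 < gauss_prob d A"
  shows "finite_second_moments d (cond_gauss d A)"
proof
  have *: "integrable (lebesgue_Rn d) (\<lambda>x. q x * cond_gauss d A x)"
    if "integrable (lebesgue_Rn d) (\<lambda>x. q x * std_gauss d x)" for q
  proof -
    have "integrable (lebesgue_Rn d) (\<lambda>x. (indicator A x *\<^sub>R (q x * std_gauss d x)) / gauss_prob d A)"
      using integrable_mult_indicator[OF A that] by (rule integrable_divide)
    then show ?thesis by (simp add: cond_gauss_def mult_ac)
  qed
  show "integrable (lebesgue_Rn d) (cond_gauss d A)"
    using *[of "\<lambda>_. 1"] integrable_std_gauss by simp
  show "(LINT x|lebesgue_Rn d. cond_gauss d A x) = 1"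
    using p by (simp add: cond_gauss_def gauss_prob_def set_lebesgue_integral_def mult.commute)
  show "integrable (lebesgue_Rn d) (\<lambda>x. x i * cond_gauss d A x)" if "i < d" for i
    using that by (intro * integrable_std_gauss_moment1)
  show "integrable (lebesgue_Rn d) (\<lambda>x. x i * x j * cond_gauss d A x)" if "i < d" "j < d" for i j
    using that by (intro * integrable_std_gauss_moment2)
qed

text \<open>In the exponent, \<open>C\<close> bounds \<open>D(h || g)\<close> and
  \<open>exp (2 * C + 1) * C\<close> bounds \<open>D(g || f)\<close>; their sum bounds
  \<open>- ln p\<close>. The divergence \<open>D(g || f)\<close> enters only through its closed form
  in \<open>m\<close> and \<open>S\<close>.\<close>

lemma gauss_prob_lower_bound:
  assumes A: "A \<in> sets (lebesgue_Rn d)" and p: "0 < gauss_prob d A" and C: "0 \<le> C"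
    and f: "kl_div d (std_gauss d) (gauss_proj d A) \<le> C"
    and fA: "kl_div d (cond_gauss d A) (gauss_proj d A) \<le> C"
  shows "exp (- (C + exp (2 * C + 1) * C)) \<le> gauss_prob d A"
proof -
  define h where "h = cond_gauss d A"
  interpret f: finite_second_moments d "std_gauss d" by (rule std_gauss_second_moments)
  interpret h: finite_second_moments d h unfolding h_def by (rule cond_gauss_second_moments[OF A p])
  have hnn: "0 \<le> h x" for x using p std_gauss_pos[of d x] by (simp add: h_def cond_gauss_def indicator_def)
  define m where "m = mean_vec d h"
  define S where "S = cov_mat d h"
  define B where "B = the (mat_inverse S)"
  have m: "m \<in> carrier_vec d" unfolding m_def by (rule h.mean_vec_carrier)
  have S: "S \<in> carrier_mat d d" "transpose_mat S = S"
    unfolding S_def by (rule h.cov_mat_carrier h.transpose_cov_mat)+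
  have pd: "0 < scalar_prod v (S *\<^sub>v v)" if "v \<in> carrier_vec d" "v \<noteq> 0\<^sub>v d" for v
    unfolding S_def using hnn that by (rule h.cov_mat_pos_def)
  have "0 < Determinant.det S \<and> mat_inverse S \<noteq> None"
    by (rule pos_def_mat_spectral[OF S pd]) (auto intro!: prod_pos)
  then have det: "0 < Determinant.det S" and inv: "mat_inverse S = Some B" by (auto simp: B_def)
  from mat_inverse(2)[OF S(1) inv] have SB: "S * B = 1\<^sub>m d" and B: "B \<in> carrier_mat d d" by auto
  define g where "g = mv_normal_density d m S"
  have proj: "gauss_proj d A = g" by (simp add: gauss_proj_def g_def m_def S_def h_def)
  have gpos: "0 < g x" for x using det by (simp add: g_def mv_normal_density_def)
  have gm: "g \<in> borel_measurable (lebesgue_Rn d)"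
    unfolding g_def using B m by (intro measurable_mv_normal_density) (simp_all add: B_def)
  have fnn: "0 \<le> std_gauss d x" for x using std_gauss_pos[of d x] by simp
  note int = B[unfolded B_def]
  have cov: "(LINT x|lebesgue_Rn d. (x i - vec_index m i) * (x j - vec_index m j) * h x) = S $$ (i,j)"
    if "i < d" "j < d" for i j using that by (simp add: S_def cov_mat_def m_def)
  have mean: "(LINT x|lebesgue_Rn d. x i * h x) = vec_index m i" if "i < d" for i
    using that by (simp add: m_def mean_vec_def)
  have "kl_div d (std_gauss d) g = (LINT x|lebesgue_Rn d. std_gauss d x * ln (std_gauss d x / g x))"
    using gm gpos fnn by (intro kl_div_eq) auto
  \<comment> \<open>Centered at \<open>m\<close>, the second moments of the standard Gaussian are
    the identity matrix plus \<open>m m^T\<close>.\<close>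
  also have "\<dots> = (ln (Determinant.det S) - real d
      + (\<Sum>i<d. \<Sum>j<d. B $$ (i,j) * ((if i = j then 1 else 0) + vec_index m i * vec_index m j))) / 2"
    unfolding g_def f.integral_ln_std_gauss_div_mv_normal[OF det int m]
    by (simp add: f.integral_centered integral_std_gauss_moment1 integral_std_gauss_moment2 B_def)
  also have "(\<Sum>i<d. \<Sum>j<d. B $$ (i,j) * ((if i = j then 1 else 0) + vec_index m i * vec_index m j)) =
      (\<Sum>i<d. B $$ (i,i)) + scalar_prod m (B *\<^sub>v m)"
  proof -
    have "(\<Sum>i<d. \<Sum>j<d. B $$ (i,j) * ((if i = j then 1 else 0) + vec_index m i * vec_index m j)) =
        (\<Sum>i<d. \<Sum>j<d. (if i = j then B $$ (i,j) else 0) + B $$ (i,j) * (vec_index m i * vec_index m j))"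
      by (intro sum.cong refl) (simp add: algebra_simps)
    then show ?thesis unfolding quadratic_form_sum[OF B m] by (simp add: sum.distrib)
  qed
  finally have "(\<Sum>i<d. B $$ (i,i)) - d + ln (Determinant.det S) + scalar_prod m (B *\<^sub>v m) \<le> 2 * C"
    using f unfolding proj by simp
  \<comment> \<open>The matrix comparison speaks of doubled divergences, so it is applied with
    \<open>2 * C\<close>.\<close>
  then have comp: "(\<Sum>i<d. S $$ (i,i)) - d - ln (Determinant.det S) + scalar_prod m m
      \<le> 2 * (exp (2 * C + 1) * C)"
    using gauss_kl_matrix_comparison[OF S pd m, of "2 * C"] C by (simp add: B_def)
  have second: "(LINT x|lebesgue_Rn d. x i * x i * h x) = S $$ (i,i) + vec_index m i * vec_index m i" if "i < d" for i
    using cov[OF that that] h.integral_centered[OF that that, of "vec_index m i" "vec_index m i"] mean[OF that]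
    by simp
  \<comment> \<open>The quadratic term of \<open>ln (f / g)\<close> integrates against
    \<open>h\<close> to this entrywise product of \<open>B\<close> and \<open>S\<close>. By symmetry
    of \<open>S\<close> it is the trace of \<open>S * B = 1\<close>, that is
    \<open>d\<close>.\<close>
  have "(\<Sum>i<d. \<Sum>j<d. B $$ (i,j) * S $$ (i,j)) = (\<Sum>j<d. \<Sum>i<d. S $$ (j,i) * B $$ (i,j))"
  proof (subst sum.swap, intro sum.cong refl)
    fix i j assume "i \<in> {..<d}" "j \<in> {..<d}"
    then have "S $$ (j,i) = S $$ (i,j)" using arg_cong[OF S(2), of "\<lambda>M. M $$ (i,j)"] S(1) by simp
    then show "B $$ (i,j) * S $$ (i,j) = S $$ (j,i) * B $$ (i,j)" by simp
  qed
  also have "\<dots> = (\<Sum>j<d. (S * B) $$ (j,j))" using S(1) B by (simp add: scalar_prod_def atLeast0LessThan)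
  finally have BS: "(\<Sum>i<d. \<Sum>j<d. B $$ (i,j) * S $$ (i,j)) = real d" by (simp add: SB)
  have "kl_div d h g = (LINT x|lebesgue_Rn d. h x * ln (h x / g x))"
    using gm gpos hnn h.integrable_density by (intro kl_div_eq) auto
  also have "\<dots> = (LINT x|lebesgue_Rn d. h x * ln (std_gauss d x / g x) - ln (gauss_prob d A) * h x)"
  proof (intro Bochner_Integration.integral_cong refl)
    fix x
    show "h x * ln (h x / g x) = h x * ln (std_gauss d x / g x) - ln (gauss_prob d A) * h x"
    \<comment> \<open>On \<open>A\<close> the density \<open>h\<close> is \<open>f / p\<close>; off
      \<open>A\<close> both sides vanish with \<open>h x\<close>.\<close>
    proof (cases "x \<in> A")
      case True
      have "ln (h x / g x) = ln (std_gauss d x / g x) - ln (gauss_prob d A)"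
        using True p gpos[of x] std_gauss_pos[of d x] by (simp add: h_def cond_gauss_def ln_div ln_mult)
      then show ?thesis by (simp only: right_diff_distrib mult.commute)
    qed (simp add: h_def cond_gauss_def)
  qed
  also have "\<dots> = (LINT x|lebesgue_Rn d. h x * ln (std_gauss d x / g x)) - ln (gauss_prob d A)"
    using h.integrable_ln_std_gauss_div_mv_normal[OF det int m] h.integrable_density
    by (simp add: g_def h.integral_density)
  also have "(LINT x|lebesgue_Rn d. h x * ln (std_gauss d x / g x)) =
      (ln (Determinant.det S) - ((\<Sum>i<d. S $$ (i,i)) + scalar_prod m m) + real d) / 2"
    unfolding g_def h.integral_ln_std_gauss_div_mv_normal[OF det int m] using BS m
    by (simp add: cov second B_def sum.distrib scalar_prod_def atLeast0LessThan)
  \<comment> \<open>The bracket is \<open>2 D(g || f)\<close>, so this is the Pythagorean identity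
    doubled.\<close>
  finally have "2 * - ln (gauss_prob d A) = 2 * kl_div d h g
      + ((\<Sum>i<d. S $$ (i,i)) - d - ln (Determinant.det S) + scalar_prod m m)"
    by (simp add: field_simps)
  also have "\<dots> \<le> 2 * C + 2 * (exp (2 * C + 1) * C)"
    using fA comp unfolding proj h_def[symmetric] by (intro add_mono) simp_all
  finally have "- ln (gauss_prob d A) \<le> C + exp (2 * C + 1) * C" by simp
  then have "- (C + exp (2 * C + 1) * C) \<le> ln (gauss_prob d A)" by simp
  then have "exp (- (C + exp (2 * C + 1) * C)) \<le> exp (ln (gauss_prob d A))" by (simp only: exp_le_cancel_iff)
  then show ?thesis using p by simp
qed

theorem theorem2p9:
  fixes A :: "nat \<Rightarrow> (nat \<Rightarrow> real) set"
  assumes "\<And>d. d \<ge> 1 \<Longrightarrow> A d \<in> sets (lebesgue_Rn d)"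
    and "\<And>d. d \<ge> 1 \<Longrightarrow> gauss_prob d (A d) > 0"
    and "(\<lambda>d. gauss_prob d (A d)) \<longlonglongrightarrow> 0"
  shows "(SUP d\<in>{1..}. ereal (kl_div d (std_gauss d) (gauss_proj d (A d)))) = \<infinity> \<or>
         (SUP d\<in>{1..}. ereal (kl_div d (cond_gauss d (A d)) (gauss_proj d (A d)))) = \<infinity>"
proof (rule ccontr)
  \<comment> \<open>The supremum is taken in \<open>ereal\<close> over real values, so a supremum
    different from infinity supplies a real bound valid in all dimensions.\<close>
  have bdd: "\<exists>C. \<forall>d\<ge>1. u d \<le> C" if "(SUP d\<in>{1..}. ereal (u d)) \<noteq> \<infinity>" for u :: "nat \<Rightarrow> real"
  proof -
    have "\<exists>C. s \<le> ereal C" if "s \<noteq> \<infinity>" for s using that by (cases s) auto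
    with that obtain C where "(SUP d\<in>{1..}. ereal (u d)) \<le> ereal C" by blast
    then show ?thesis by (auto simp: SUP_le_iff)
  qed
  assume *: "\<not> ?thesis"
  obtain C1 where C1: "\<And>d. 1 \<le> d \<Longrightarrow> kl_div d (std_gauss d) (gauss_proj d (A d)) \<le> C1"
    using bdd[of "\<lambda>d. kl_div d (std_gauss d) (gauss_proj d (A d))"] * by blast
  obtain C2 where C2: "\<And>d. 1 \<le> d \<Longrightarrow> kl_div d (cond_gauss d (A d)) (gauss_proj d (A d)) \<le> C2"
    using bdd[of "\<lambda>d. kl_div d (cond_gauss d (A d)) (gauss_proj d (A d))"] * by blast
  \<comment> \<open>The maximum with 0 secures the nonnegativity that the lower bound
    requires.\<close>
  define C where "C = max 0 (max C1 C2)"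
  have "exp (- (C + exp (2 * C + 1) * C)) \<le> gauss_prob d (A d)" if "1 \<le> d" for d
    using assms(1,2)[OF that] C1[OF that] C2[OF that]
    by (intro gauss_prob_lower_bound) (auto simp: C_def)
  then have "\<forall>\<^sub>F d in sequentially. exp (- (C + exp (2 * C + 1) * C)) \<le> gauss_prob d (A d)"
    unfolding eventually_sequentially by (intro exI[of _ 1]) simp
  then have "exp (- (C + exp (2 * C + 1) * C)) \<le> 0"
    by (rule tendsto_lowerbound[OF assms(3)]) simp
  then show False by simp
qed

end
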